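(* For any integers $n\geq i\geq 0$, there holds $$P_{n+1,0}=S_{n+1}+U_{n,0}+H_{n,0},$$ $$P_{n+1,i+1}=\sum_{j=0}^{n-i}(-1)^{j}\sum_{m=0}^{n-i-j}\binom{n+m+i-j+3}{n-i-j-m}C_{m}^{(2i+4)}+\sum_{j=0}^{n-i-2}(-1)^{j}\sum_{m=0}^{n-i-j-2}\binom{n+m+i-j+1}{n-i-j-m-2}C_{m}^{(2i+4)}.$$ Moreover, $P_{n+1,i+1}$ is the $(n,i)$-entry of the Riordan array $$\Big(\frac{(1+x^2)S(x)^{4}}{1+x},\ xS(x)^2\Big).$$
   Context: A G-Motzkin path of length $n$ is a lattice path from $(0,0)$ to $(n,0)$ in the first quadrant (never going below the $x$-axis) consisting of up steps $\mathbf{u}=(1,1)$, down steps $\mathbf{d}=(1,-1)$, horizontal steps $\mathbf{h}=(1,0)$ and vertical steps $\mathbf{v}=(0,-1)$. It is $\mathbf{uvu}$-avoiding if it contains no three consecutive steps $\mathbf{u},\mathbf{v},\mathbf{u}$. $\mathcal{G}_{n}^{\mathbf{uvu}}$ is the set of all (unweighted) $\mathbf{uvu}$-avoiding G-Motzkin paths of length $n$. The points of a path are its starting point and the endpoints of its steps (so a path with $k$ steps has $k+1$ points). A point with ordinate $\ell$ is at level $\ell$; a step is at level $\ell$ if the ordinate of its endpoint is $\ell$. $P_{n,i}$ is the total number of points at level $i$ in all paths $\mathbf{G}\in\mathcal{G}_{n}^{\mathbf{uvu}}$. $U_{n,i}$ is the total number of $\mathbf{u}$-steps at level $i+1$, and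 $H_{n,i}$ the total number of $\mathbf{h}$-steps at level $i$, in all paths $\mathbf{G}\in\mathcal{G}_{n+1}^{\mathbf{uvu}}$. $S_n$ is the $n$-th large Schröder number, i.e. the number of lattice paths from $(0,0)$ to $(2n,0)$ never going below the $x$-axis with steps $(1,1)$, $(1,-1)$, $(2,0)$, and $S(x)=\sum_{n\ge0}S_nx^n=\frac{1-x-\sqrt{1-6x+x^2}}{2x}$. Also $C_{m}^{(k)}=\frac{k}{m+k}\binom{2m+k}{m}$. A sum whose upper limit is smaller than its lower limit is $0$. For formal power series $d(x),h(x)$ with $d(0)=1$, $h(0)=0$, the Riordan array $(d(x),h(x))$ is the infinite lower triangular matrix $(d_{n,i})_{n,i\ge 0}$ with $d_{n,i}=[x^n]\,d(x)h(x)^i$, where $[x^n]$ denotes the coefficient of $x^n$.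
   Formalization: The formula for C_m^{(k)} is corrected from k/(m+k) binom(2m+k,m) to k/(2m+k) binom(2m+k,m); with the former the second identity fails, e.g. for n=1, i=0 its right side is 39/5, not an integer. *)

theory Defs
  imports "HOL-Library.Product_Plus" "HOL-Library.Sublist"
    "HOL-Computational_Algebra.Formal_Power_Series"
begin

text \<open>A path is the list of its step vectors; it starts at the origin, and
  \<open>path_point w k\<close> is the point reached after its first \<open>k\<close> steps.\<close>

type_synonym lattice_path = "(int \<times> int) list"

definition path_point :: "lattice_path \<Rightarrow> nat \<Rightarrow> int \<times> int" where
  "path_point w k = sum_list (take k w)"

definition lattice_paths :: "(int \<times> int) set \<Rightarrow> int \<times> int \<Rightarrow> lattice_path set" where
  "lattice_paths A p =
    {w. set w \<subseteq> A \<and> path_point w (length w) = p \<and>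
        (\<forall>k\<le>length w. 0 \<le> snd (path_point w k))}"

definition up_step :: "int \<times> int" where "up_step = (1, 1)"
definition down_step :: "int \<times> int" where "down_step = (1, -1)"
definition horiz_step :: "int \<times> int" where "horiz_step = (1, 0)"
definition vert_step :: "int \<times> int" where "vert_step = (0, -1)"

definition g_motzkin_paths :: "nat \<Rightarrow> lattice_path set" where
  "g_motzkin_paths n =
    lattice_paths {up_step, down_step, horiz_step, vert_step} (int n, 0)"

text \<open>The relation \<^const>\<open>sublist\<close> requires the elements to occur consecutively.\<close>

definition uvu_avoiding_paths :: "nat \<Rightarrow> lattice_path set" where
  "uvu_avoiding_paths n =
    {w \<in> g_motzkin_paths n. \<not> sublist [up_step, vert_step, up_step] w}"

definition points_at_level :: "nat \<Rightarrow> lattice_path \<Rightarrow> nat" where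
  "points_at_level l w = card {k. k \<le> length w \<and> snd (path_point w k) = int l}"

text \<open>The level of a step is the ordinate of its endpoint.\<close>

definition steps_at_level :: "int \<times> int \<Rightarrow> nat \<Rightarrow> lattice_path \<Rightarrow> nat" where
  "steps_at_level s l w =
    card {k. k < length w \<and> w ! k = s \<and> snd (path_point w (Suc k)) = int l}"

definition P_num :: "nat \<Rightarrow> nat \<Rightarrow> nat" where
  "P_num n i = (\<Sum>w\<in>uvu_avoiding_paths n. points_at_level i w)"

text \<open>The index shifts in the next two definitions are part of the convention: both count
  over paths of length \<open>n + 1\<close>, and only the \<open>u\<close>-steps are counted at level \<open>i + 1\<close>.\<close>

definition U_num :: "nat \<Rightarrow> nat \<Rightarrow> nat" where
  "U_num n i = (\<Sum>w\<in>uvu_avoiding_paths (n + 1). steps_at_level up_step (i + 1) w)"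

definition H_num :: "nat \<Rightarrow> nat \<Rightarrow> nat" where
  "H_num n i = (\<Sum>w\<in>uvu_avoiding_paths (n + 1). steps_at_level horiz_step i w)"

definition schroeder :: "nat \<Rightarrow> nat" where
  "schroeder n = card (lattice_paths {(1, 1), (1, -1), (2, 0)} (2 * int n, 0))"

definition schroeder_fps :: "rat fps" where
  "schroeder_fps = Abs_fps (\<lambda>n. of_nat (schroeder n))"

text \<open>The number \<open>C\<^sub>m\<^sup>(\<^sup>k\<^sup>)\<close>, the coefficient of \<open>x\<^sup>m\<close> in the \<open>k\<close>-th power of the
  Catalan generating function. It is also sometimes printed with prefactor \<open>k / (m + k)\<close>;
  that is correct only together with \<open>(2 * m + k - 1) choose m\<close>, and is a misprint
  next to \<open>(2 * m + k) choose m\<close>.\<close>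

definition catalan_conv :: "nat \<Rightarrow> nat \<Rightarrow> rat" where
  "catalan_conv k m = of_nat k / of_nat (2 * m + k) * of_nat ((2 * m + k) choose m)"

text \<open>This is meant for \<open>d(0) = 1\<close> and \<open>h(0) = 0\<close>; the last lemma below establishes
  that for the array in question.\<close>

definition riordan_array :: "'a::comm_semiring_1 fps \<Rightarrow> 'a fps \<Rightarrow> nat \<Rightarrow> nat \<Rightarrow> 'a" where
  "riordan_array d h n i = fps_nth (d * h ^ i) n"

lemma schroeder_0: "schroeder 0 = 1"
proof -
  have "w = []" if "w \<in> lattice_paths {(1, 1), (1, -1), (2, 0)} (0, 0)" for w
  proof (rule ccontr)
    assume "w \<noteq> []"
    have len: "int (length v) \<le> fst (sum_list v)"
      if "set v \<subseteq> {(1, 1), (1, -1), (2::int, 0::int)}" for v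
      using that by (induction v) auto
    from that have "int (length w) \<le> 0"
      using len[of w] by (auto simp: lattice_paths_def path_point_def)
    with \<open>w \<noteq> []\<close> show False by simp
  qed
  moreover have "[] \<in> lattice_paths {(1, 1), (1, -1), (2, 0)} (0, 0)"
    by (simp add: lattice_paths_def path_point_def zero_prod_def)
  ultimately have "lattice_paths {(1, 1), (1, -1), (2, 0)} (0, 0) = {[]}"
    by blast
  then show ?thesis by (simp add: schroeder_def)
qed

lemma riordan_conditions:
  "fps_nth ((1 + fps_X ^ 2) * schroeder_fps ^ 4 / (1 + fps_X)) 0 = 1"
  "fps_nth (fps_X * schroeder_fps ^ 2) 0 = 0"
  by (simp_all add: fps_divide_unit schroeder_fps_def schroeder_0 fps_power_zeroth)

end

theory Submission imports Defs begin

text \<open>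
  Cut a nonempty \<open>uvu\<close>-avoiding path at its first return to the axis: it is \<open>h w\<close>,
  \<open>u a d b\<close> or \<open>u a v b\<close>. Only in the last form can a new \<open>uvu\<close> arise, namely when \<open>a\<close> is empty
  and \<open>b\<close> starts with \<open>u\<close>. Write \<open>G\<close> for the generating function of all these paths and \<open>B\<close> for
  that of the paths starting with \<open>u\<close>. Then \<open>G = 1 + x G + B\<close> and
  \<open>B = x\<^sup>2 G\<^sup>2 + x (G\<^sup>2 - B)\<close>; the factor \<open>1 + x\<close> cancels, so \<open>B = x G\<^sup>2\<close> and
  \<open>G = 1 + x G + x G\<^sup>2\<close>. That is the equation of the Schroeder series, so \<open>G = S\<close>.

  Let \<open>F\<^sub>l\<close> count the points at level \<open>l\<close>. Raising \<open>a\<close> by the initial \<open>u\<close> turns level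
  \<open>l - 1\<close> into level \<open>l\<close>, so the same decomposition relates \<open>F\<^sub>l\<close> to
  \<open>F\<^bsub>l-1\<^esub>\<close> linearly, and \<open>1 - x - x S = 1 / S\<close> solves for \<open>F\<^sub>l\<close>:
  \<open>F\<^sub>0 = S\<^sup>2 - x\<^sup>2 S\<^sup>3 / (1 + x)\<close>,
  \<open>F\<^sub>1 = x S\<^sup>2 F\<^sub>0 - x\<^sup>2 S\<^sup>3 / (1 + x) = x (1 + x\<^sup>2) S\<^sup>4 / (1 + x)\<close>, and
  \<open>F\<^sub>l = x S\<^sup>2 F\<^bsub>l-1\<^esub>\<close> for \<open>l \<ge> 2\<close>, because only levels \<open>0\<close> and \<open>1\<close> feel the
  excluded configuration. This is the Riordan array.

  For the double sums, \<open>S(x) = C(x / (1 - x)\<^sup>2) / (1 - x)\<close> with \<open>C\<close> the Catalan series,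
  so \<open>[x\<^sup>N] S\<^sup>k\<close> is a sum of \<open>C\<^sub>m\<^sup>(\<^sup>k\<^sup>)\<close> times a binomial coefficient. No composition of
  series is used: both sides satisfy \<open>(1 - x) S\<^sup>k = S\<^bsup>k-1\<^esup> + x S\<^bsup>k+1\<^esup>\<close>
  coefficientwise, with the same initial values. The factor \<open>1 / (1 + x)\<close> contributes the alternating sums
  and \<open>1 + x\<^sup>2\<close> the two summands.

  The identity for level \<open>0\<close> holds path by path up to the constant \<open>1\<close>: a point on the axis is the start,
  the end of an \<open>h\<close>, or the end of a descent from level \<open>1\<close>, and the descents are as many as
  the ascents to level \<open>1\<close>. The constants add up to \<open>S\<^bsub>n+1\<^esub>\<close>, the number of paths.
\<close>

section \<open>Generating functions of graded classes\<close>

definition graded_finite :: "('a \<Rightarrow> nat) \<Rightarrow> 'a set \<Rightarrow> bool" where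
  "graded_finite sz S \<longleftrightarrow> (\<forall>n. finite {x. x \<in> S \<and> sz x = n})"

text \<open>With \<open>f = 1\<close> this is the ordinary generating function of \<open>S\<close> graded by \<open>sz\<close>. The sum is \<open>0\<close>
  in a degree with infinitely many elements; this is why the lemmas below ask for
  \<^const>\<open>graded_finite\<close>.\<close>

definition ogf :: "('a \<Rightarrow> nat) \<Rightarrow> ('a \<Rightarrow> rat) \<Rightarrow> 'a set \<Rightarrow> rat fps" where
  "ogf sz f S = Abs_fps (\<lambda>n. \<Sum>x | x \<in> S \<and> sz x = n. f x)"

lemma graded_finite_subset: "graded_finite sz T \<Longrightarrow> S \<subseteq> T \<Longrightarrow> graded_finite sz S"
  unfolding graded_finite_def by (blast intro: rev_finite_subset)

lemma graded_fibres_Times: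
  "{z. z \<in> S \<times> T \<and> (\<lambda>(x, y). s x + t y) z = (n::nat)} =
   (\<Union>i\<in>{0..n}. {x. x \<in> S \<and> s x = i} \<times> {y. y \<in> T \<and> t y = n - i})"
  by auto

lemma graded_finite_Times:
  assumes "graded_finite s S" "graded_finite t T"
  shows "graded_finite (\<lambda>(x, y). s x + t y) (S \<times> T)"
  unfolding graded_finite_def graded_fibres_Times using assms
  by (auto simp: graded_finite_def)

lemma graded_finite_image:
  assumes "graded_finite s S" and "\<And>x. x \<in> S \<Longrightarrow> sz (\<phi> x) = s x + c"
  shows "graded_finite sz (\<phi> ` S)"
  unfolding graded_finite_def
proof
  fix n
  have "{y. y \<in> \<phi> ` S \<and> sz y = n} \<subseteq> \<phi> ` {x. x \<in> S \<and> s x = n - c}"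
    using assms(2) by auto
  then show "finite {y. y \<in> \<phi> ` S \<and> sz y = n}"
    using assms(1) unfolding graded_finite_def by (meson finite_imageI finite_subset)
qed

lemma ogf_cong: "(\<And>x. x \<in> S \<Longrightarrow> f x = g x) \<Longrightarrow> ogf sz f S = ogf sz g S"
  by (auto simp: ogf_def fps_eq_iff intro: sum.cong)

lemma ogf_add: "ogf sz (\<lambda>x. f x + g x) S = ogf sz f S + ogf sz g S"
  by (simp add: ogf_def fps_eq_iff sum.distrib)

lemma ogf_const: "ogf sz (\<lambda>x. c) S = fps_const c * ogf sz (\<lambda>x. 1) S"
  by (simp add: ogf_def fps_eq_iff)

lemma ogf_zero: "ogf sz (\<lambda>x. 0) S = 0"
  by (simp add: ogf_def fps_eq_iff)

lemma ogf_singleton: "sz a = 0 \<Longrightarrow> ogf sz f {a} = fps_const (f a)"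
proof -
  assume "sz a = 0"
  then have "{x. x \<in> {a} \<and> sz x = n} = (if n = 0 then {a} else {})" for n
    by auto
  then show ?thesis by (simp add: ogf_def fps_eq_iff)
qed

lemma ogf_Un:
  assumes "graded_finite sz S" "graded_finite sz T" "S \<inter> T = {}"
  shows "ogf sz f (S \<union> T) = ogf sz f S + ogf sz f T"
proof -
  have "{x. x \<in> S \<union> T \<and> sz x = n} = {x. x \<in> S \<and> sz x = n} \<union> {x. x \<in> T \<and> sz x = n}" for n
    by auto
  moreover have "{x. x \<in> S \<and> sz x = n} \<inter> {x. x \<in> T \<and> sz x = n} = {}" for n
    using assms(3) by auto
  ultimately show ?thesis
    using assms by (simp add: ogf_def fps_eq_iff graded_finite_def sum.union_disjoint)
qed

lemma ogf_Diff:
  assumes "graded_finite sz S" "T \<subseteq> S"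
  shows "ogf sz f (S - T) = ogf sz f S - ogf sz f T"
proof -
  have "ogf sz f ((S - T) \<union> T) = ogf sz f (S - T) + ogf sz f T"
    using assms by (intro ogf_Un) (auto intro: graded_finite_subset)
  then show ?thesis using assms(2) by (simp add: Un_absorb2)
qed

lemma ogf_image:
  assumes "inj_on \<phi> S"
    and sz: "\<And>x. x \<in> S \<Longrightarrow> sz (\<phi> x) = s x + c"
  shows "ogf sz f (\<phi> ` S) = fps_X ^ c * ogf s (\<lambda>x. f (\<phi> x)) S"
proof (rule fps_ext)
  fix n
  have "{y. y \<in> \<phi> ` S \<and> sz y = n} = \<phi> ` {x. x \<in> S \<and> s x + c = n}"
    using sz by auto
  then have "fps_nth (ogf sz f (\<phi> ` S)) n = (\<Sum>x | x \<in> S \<and> s x + c = n. f (\<phi> x))"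
    using assms(1) by (simp add: ogf_def sum.reindex inj_on_subset)
  also have "\<dots> = fps_nth (fps_X ^ c * ogf s (\<lambda>x. f (\<phi> x)) S) n"
  proof (cases "n < c")
    case False
    then have "{x. x \<in> S \<and> s x + c = n} = {x. x \<in> S \<and> s x = n - c}" by auto
    with False show ?thesis by (simp add: fps_X_power_mult_nth ogf_def)
  next
    case True
    then have "{x. x \<in> S \<and> s x + c = n} = {}" by auto
    then show ?thesis using True by (simp only: fps_X_power_mult_nth sum.empty) simp
  qed
  finally show "fps_nth (ogf sz f (\<phi> ` S)) n = fps_nth (fps_X ^ c * ogf s (\<lambda>x. f (\<phi> x)) S) n" .
qed

lemma ogf_Times:
  assumes "graded_finite s S" "graded_finite t T"
  shows "ogf (\<lambda>(x, y). s x + t y) (\<lambda>(x, y). f x * g y) (S \<times> T) = ogf s f S * ogf t g T"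
proof (rule fps_ext)
  fix n
  let ?A = "\<lambda>i. {x. x \<in> S \<and> s x = i}" and ?B = "\<lambda>i. {y. y \<in> T \<and> t y = i}"
  have fin: "finite (?A i)" "finite (?B i)" for i
    using assms by (auto simp: graded_finite_def)
  have "fps_nth (ogf (\<lambda>(x, y). s x + t y) (\<lambda>(x, y). f x * g y) (S \<times> T)) n =
      (\<Sum>z\<in>(\<Union>i\<in>{0..n}. ?A i \<times> ?B (n - i)). (\<lambda>(x, y). f x * g y) z)"
    unfolding ogf_def fps_nth_Abs_fps graded_fibres_Times ..
  also have "\<dots> = (\<Sum>i=0..n. \<Sum>z\<in>?A i \<times> ?B (n - i). (\<lambda>(x, y). f x * g y) z)"
    using fin by (intro sum.UNION_disjoint) auto
  also have "\<dots> = (\<Sum>i=0..n. sum f (?A i) * sum g (?B (n - i)))"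
    by (simp add: sum_product sum.cartesian_product)
  also have "\<dots> = fps_nth (ogf s f S * ogf t g T) n"
    by (simp add: fps_mult_nth ogf_def)
  finally show "fps_nth (ogf (\<lambda>(x, y). s x + t y) (\<lambda>(x, y). f x * g y) (S \<times> T)) n =
      fps_nth (ogf s f S * ogf t g T) n" .
qed

text \<open>The form needed for statistics that are additive over the two parts of a decomposed path.\<close>

lemma ogf_Times_sum:
  assumes "graded_finite s S" "graded_finite t T"
  shows "ogf (\<lambda>(x, y). s x + t y) (\<lambda>(x, y). f x + g y) (S \<times> T) =
    ogf s f S * ogf t (\<lambda>_. 1) T + ogf s (\<lambda>_. 1) S * ogf t g T"
proof -
  have "(\<lambda>(x, y). f x + g y) = (\<lambda>z. (\<lambda>(x, y). f x * 1) z + (\<lambda>(x, y). 1 * g y) z)"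
    by auto
  then show ?thesis
    by (simp only: ogf_add ogf_Times[OF assms])
qed

section \<open>First-return decomposition of lattice excursions\<close>

definition height :: "lattice_path \<Rightarrow> int" where
  "height w = snd (sum_list w)"

lemma height_simps [simp]:
  "height [] = 0" "height (s # w) = snd s + height w" "height (a @ b) = height a + height b"
  by (auto simp: height_def)

text \<open>Quantifying over prefixes instead of positions lets the standard rules for prefixes of
  \<open>s # w\<close> and \<open>a @ b\<close> do the index arithmetic.\<close>

definition excursions :: "(int \<times> int) set \<Rightarrow> lattice_path set" where
  "excursions A = {w. set w \<subseteq> A \<and> height w = 0 \<and> (\<forall>p. prefix p w \<longrightarrow> 0 \<le> height p)}"

lemma all_prefix_iff_take: "(\<forall>p. prefix p w \<longrightarrow> Q p) \<longleftrightarrow> (\<forall>k\<le>length w. Q (take k w))"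
proof
  assume "\<forall>k\<le>length w. Q (take k w)"
  then show "\<forall>p. prefix p w \<longrightarrow> Q p"
    by (metis append_eq_conv_conj prefixE prefix_length_le)
qed (simp add: take_is_prefix)

lemma lattice_paths_eq_excursions:
  "lattice_paths A (x, 0) = {w \<in> excursions A. fst (sum_list w) = x}"
  by (auto simp: lattice_paths_def excursions_def path_point_def height_def all_prefix_iff_take
      prod_eq_iff)

lemma Nil_in_excursions [simp]: "[] \<in> excursions A"
  by (simp add: excursions_def)

lemma excursion_Cons_height: "s # w \<in> excursions A \<Longrightarrow> 0 \<le> snd s"
  by (auto simp: excursions_def dest!: spec[of _ "[s]"])

lemma excursion_snoc_height: "w @ [s] \<in> excursions A \<Longrightarrow> snd s \<le> 0"
  by (auto simp: excursions_def dest!: spec[of _ w])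

lemma level_step_excursion:
  assumes "snd s = 0"
  shows "s # w \<in> excursions A \<longleftrightarrow> s \<in> A \<and> w \<in> excursions A"
proof
  assume *: "s # w \<in> excursions A"
  have "0 \<le> height p" if "prefix p w" for p
    using * that assms by (auto simp: excursions_def dest!: spec[of _ "s # p"])
  then show "s \<in> A \<and> w \<in> excursions A"
    using * assms by (auto simp: excursions_def)
next
  assume "s \<in> A \<and> w \<in> excursions A"
  then show "s # w \<in> excursions A"
    using assms by (auto simp: excursions_def prefix_Cons)
qed

lemma arch_excursionI:
  assumes "u \<in> A" "snd u = 1" "d \<in> A" "snd d = -1" "a \<in> excursions A" "b \<in> excursions A"
  shows "u # a @ d # b \<in> excursions A"
  using assms by (auto simp: excursions_def prefix_Cons prefix_append)

text \<open>Since no step falls by more than one, the first prefix below the starting level ends with a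
  step from height \<open>0\<close> to height \<open>-1\<close>.\<close>

lemma first_descent:
  assumes "set w \<subseteq> A" "\<And>s. s \<in> A \<Longrightarrow> -1 \<le> snd s" "height w < 0"
  obtains a d b where "w = a @ d # b" "a \<in> excursions A" "snd d = -1"
proof -
  define k where "k = (LEAST k. height (take k w) < 0)"
  have neg: "height (take k w) < 0"
    unfolding k_def by (rule LeastI[of _ "length w"]) (simp add: assms(3))
  have before: "0 \<le> height (take j w)" if "j < k" for j
    using not_less_Least[of j "\<lambda>k. height (take k w) < 0"] that by (simp add: k_def not_less)
  have "k \<noteq> 0" using neg by (cases k) auto
  then obtain m where k: "k = Suc m" by (cases k) auto
  have m: "m < length w"
  proof (rule ccontr)
    assume "\<not> m < length w"
    then have "take k w = take m w" using k by simp
    then show False using neg before[of m] k by simp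
  qed
  have split: "w = take m w @ w ! m # drop (Suc m) w"
    by (rule id_take_nth_drop[OF m])
  have "w ! m \<in> A" using assms(1) m by auto
  moreover have "height (take k w) = height (take m w) + snd (w ! m)"
    using m by (simp add: k take_Suc_conv_app_nth)
  ultimately have "height (take m w) = 0 \<and> snd (w ! m) = -1"
    using neg before[of m] assms(2)[of "w ! m"] k by auto
  moreover have "0 \<le> height p" if p: "prefix p (take m w)" for p
  proof -
    obtain r where r: "take m w = p @ r" using p by (auto simp: prefix_def)
    have "length p \<le> m" using arg_cong[OF r, of length] by simp
    moreover have "take (length p) (take m w) = p" by (simp add: r)
    ultimately have "take (length p) w = p" "length p \<le> m" by (simp_all add: min_absorb1)
    then show ?thesis using before[of "length p"] k by simp
  qed
  ultimately have "take m w \<in> excursions A" "snd (w ! m) = -1"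
    using assms(1) by (auto simp: excursions_def dest: in_set_takeD)
  with split show thesis by (rule that)
qed

text \<open>If one excursion were longer, it would have the shorter one followed by its descent as a
  prefix, which lies below the axis.\<close>

lemma first_descent_unique:
  assumes eq: "a @ d # b = a' @ d' # b'"
    and a: "a \<in> excursions A" "a' \<in> excursions A" and d: "snd d = -1" "snd d' = -1"
  shows "a = a' \<and> d = d' \<and> b = b'"
proof -
  have no: False
    if "x @ e # y = x' @ z" "length x < length x'" "x \<in> excursions A" "x' \<in> excursions A"
      "snd e = -1" for x e y x' z
  proof -
    have "prefix (x @ [e]) (x' @ z)"
      using that(1)[symmetric] by (simp add: prefix_def)
    then have "prefix (x @ [e]) x'"
      by (rule prefix_length_prefix) (use that(2) in \<open>simp_all add: prefix_def\<close>)
    then have "0 \<le> height (x @ [e])" using that(4) by (auto simp: excursions_def)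
    then show False using that(3,5) by (auto simp: excursions_def)
  qed
  have "length a = length a'"
    using no[of a d b a' "d' # b'"] no[of a' d' b' a "d # b"] eq a d by (metis linorder_neqE_nat)
  then show ?thesis using eq by simp
qed

text \<open>First-return decomposition: after an initial up step, the rest of the path has total height
  \<open>-1\<close> and splits at its first descent below level \<open>1\<close>.\<close>

lemma excursions_unfold:
  assumes A: "\<And>s. s \<in> A \<Longrightarrow> snd s \<in> {-1, 0, 1}"
  shows "w \<in> excursions A \<longleftrightarrow> w = [] \<or>
    (\<exists>s\<in>A. \<exists>w'\<in>excursions A. snd s = 0 \<and> w = s # w') \<or>
    (\<exists>u\<in>A. \<exists>d\<in>A. \<exists>a\<in>excursions A. \<exists>b\<in>excursions A.
       snd u = 1 \<and> snd d = -1 \<and> w = u # a @ d # b)"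
    (is "?L \<longleftrightarrow> ?R")
proof
  assume w: ?L
  show ?R
  proof (cases w)
    case (Cons s w')
    then have s: "s \<in> A" and w': "set w' \<subseteq> A" using w by (auto simp: excursions_def)
    consider "snd s = 0" | "snd s = 1"
      using A[OF s] excursion_Cons_height[of s w' A] w Cons by auto
    then show ?thesis
    proof cases
      case 1
      then show ?thesis using Cons w level_step_excursion[of s w' A] by auto
    next
      case 2
      have "height w' < 0" using w Cons 2 by (auto simp: excursions_def)
      moreover have "-1 \<le> snd s" if "s \<in> A" for s using A[OF that] by auto
      ultimately obtain a d b where split: "w' = a @ d # b" "a \<in> excursions A" "snd d = -1"
        using first_descent[OF w'] by blast
      have "0 \<le> height p" if "prefix p b" for p
      proof -
        have "prefix (s # a @ d # p) w" using that by (simp add: Cons split)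
        then have "0 \<le> height (s # a @ d # p)" using w by (auto simp: excursions_def)
        then show ?thesis using split 2 by (simp add: excursions_def)
      qed
      then have "b \<in> excursions A"
        using w Cons split 2 by (auto simp: excursions_def)
      then show ?thesis using Cons split s w' 2 by auto
    qed
  qed simp
next
  assume ?R
  then show ?L by (auto simp: level_step_excursion intro: arch_excursionI)
qed

lemma inj_on_arch:
  assumes "snd d = -1" "S \<subseteq> excursions A \<times> UNIV"
  shows "inj_on (\<lambda>(a, b). u # a @ d # b) S"
proof (rule inj_onI)
  fix p q assume *: "p \<in> S" "q \<in> S" "(\<lambda>(a, b). u # a @ d # b) p = (\<lambda>(a, b). u # a @ d # b) q"
  obtain a b a' b' where pq: "p = (a, b)" "q = (a', b')" by fastforce
  have "a \<in> excursions A" "a' \<in> excursions A" using * pq assms(2) by auto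
  then show "p = q"
    using first_descent_unique[of a d b a' d b' A] * pq assms(1) by simp
qed

text \<open>The weight hypothesis allows steps of weight \<open>0\<close> as long as they descend. Summed over a path
  that ends on the axis it bounds the number of steps by twice the total weight.\<close>

lemma excursions_graded_finite:
  assumes "finite A"
    and "\<And>s. s \<in> A \<Longrightarrow> 1 \<le> 2 * int (\<omega> s) - snd s"
  shows "graded_finite (\<lambda>w. sum_list (map \<omega> w)) (excursions A)"
  unfolding graded_finite_def
proof
  fix n
  have len: "int (length w) \<le> 2 * int (sum_list (map \<omega> w)) - height w" if "set w \<subseteq> A" for w
    using that by (induction w) (auto dest!: assms(2))
  have "{w. w \<in> excursions A \<and> sum_list (map \<omega> w) = n} \<subseteq> {w. set w \<subseteq> A \<and> length w \<le> 2 * n}"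
    using len by (fastforce simp: excursions_def)
  then show "finite {w. w \<in> excursions A \<and> sum_list (map \<omega> w) = n}"
    using finite_lists_length_le[OF assms(1)] by (rule finite_subset)
qed

section \<open>The large Schroeder numbers\<close>

abbreviation schroeder_steps :: "(int \<times> int) set" where
  "schroeder_steps \<equiv> {(1, 1), (1, -1), (2, 0)}"

text \<open>Abscissa plus height is \<open>2\<close>, \<open>0\<close> and \<open>2\<close> for the three steps, and half of it is the weight. On
  paths ending on the axis the total weight is therefore half of the abscissa.\<close>

definition schroeder_weight :: "int \<times> int \<Rightarrow> nat" where
  "schroeder_weight s = (if s = (1, -1) then 0 else 1)"

abbreviation semilength :: "lattice_path \<Rightarrow> nat" where
  "semilength w \<equiv> sum_list (map schroeder_weight w)"

lemma schroeder_paths_eq: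
  "lattice_paths schroeder_steps (2 * int n, 0) = {w. w \<in> excursions schroeder_steps \<and> semilength w = n}"
proof -
  have "fst (sum_list w) = 2 * int (semilength w) - height w" if "set w \<subseteq> schroeder_steps" for w
    using that by (induction w) (auto simp: schroeder_weight_def)
  then have "fst (sum_list w) = 2 * int (semilength w)" if "w \<in> excursions schroeder_steps" for w
    using that by (auto simp: excursions_def)
  then show ?thesis by (auto simp: lattice_paths_eq_excursions)
qed

lemma schroeder_fps_eq: "schroeder_fps = 1 + fps_X * schroeder_fps + fps_X * schroeder_fps ^ 2"
proof -
  let ?E = "excursions schroeder_steps" and ?arch = "\<lambda>(a, b). (1, 1) # a @ (1, -1) # b"
  let ?H = "(#) (2, 0) ` ?E" and ?U = "?arch ` (?E \<times> ?E)"
  let ?sz2 = "\<lambda>(a, b). semilength a + semilength b"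
  have fin: "graded_finite semilength ?E"
    by (rule excursions_graded_finite) (auto simp: schroeder_weight_def)
  have fin2: "graded_finite ?sz2 (?E \<times> ?E)"
    by (rule graded_finite_Times[OF fin fin])
  have gf: "schroeder_fps = ogf semilength (\<lambda>_. 1) ?E"
    by (simp add: schroeder_fps_def schroeder_def schroeder_paths_eq ogf_def)
  have "?E = {[]} \<union> (?H \<union> ?U)"
    by (rule set_eqI, subst excursions_unfold) (auto simp: image_iff)
  moreover have "graded_finite semilength ?H"
    by (rule graded_finite_image[OF fin, where c = 1]) (simp add: schroeder_weight_def)
  moreover have "graded_finite semilength ?U"
    by (rule graded_finite_image[OF fin2, where c = 1]) (auto simp: schroeder_weight_def)
  moreover have "graded_finite semilength {[]}"
    by (simp add: graded_finite_def)
  moreover have "graded_finite semilength (?H \<union> ?U)"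
    by (rule graded_finite_subset[OF fin]) (use calculation(1) in blast)
  moreover have "{[]} \<inter> (?H \<union> ?U) = {}" "?H \<inter> ?U = {}" by auto
  ultimately have "ogf semilength (\<lambda>_. 1) ?E = ogf semilength (\<lambda>_. 1) {[]} +
      (ogf semilength (\<lambda>_. 1) ?H + ogf semilength (\<lambda>_. 1) ?U)"
    by (metis ogf_Un)
  also have "ogf semilength (\<lambda>_. 1) {[]} = 1"
    by (simp add: ogf_singleton)
  also have "ogf semilength (\<lambda>_. 1) ?H = fps_X ^ 1 * ogf semilength (\<lambda>_. 1) ?E"
    by (rule ogf_image) (auto simp: schroeder_weight_def)
  also have "ogf semilength (\<lambda>_. 1) ?U = fps_X ^ 1 * ogf ?sz2 (\<lambda>_. 1) (?E \<times> ?E)"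
    by (rule ogf_image) (auto simp: schroeder_weight_def intro!: inj_on_arch[where A = schroeder_steps])
  also have "ogf ?sz2 (\<lambda>_. 1) (?E \<times> ?E) = ogf semilength (\<lambda>_. 1) ?E * ogf semilength (\<lambda>_. 1) ?E"
    using ogf_Times[OF fin fin, of "\<lambda>_. 1" "\<lambda>_. 1"] by (simp add: case_prod_beta')
  finally show ?thesis by (simp add: gf power2_eq_square add.assoc)
qed

text \<open>For two solutions \<open>G\<close> and \<open>S\<close> one has \<open>(G - S) (1 - x - x (G + S)) = 0\<close>, where the second factor
  has constant coefficient \<open>1\<close>.\<close>

lemma schroeder_fps_unique:
  assumes "G = 1 + fps_X * G + fps_X * G ^ 2"
  shows "G = schroeder_fps"
proof -
  have "(G - schroeder_fps) * (1 - fps_X - fps_X * (G + schroeder_fps)) = 0"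
    using assms schroeder_fps_eq by algebra
  moreover have "fps_nth (1 - fps_X - fps_X * (G + schroeder_fps)) 0 = 1" by simp
  then have "1 - fps_X - fps_X * (G + schroeder_fps) \<noteq> 0" by (metis fps_zero_nth zero_neq_one)
  ultimately show ?thesis by simp
qed

section \<open>Decomposing paths without uvu\<close>

abbreviation g_steps :: "(int \<times> int) set" where
  "g_steps \<equiv> {up_step, down_step, horiz_step, vert_step}"

lemmas step_defs = up_step_def down_step_def horiz_step_def vert_step_def

definition path_length :: "lattice_path \<Rightarrow> nat" where
  "path_length w = sum_list (map (\<lambda>s. nat (fst s)) w)"

definition uvu_free :: "lattice_path set" where
  "uvu_free = {w \<in> excursions g_steps. \<not> sublist [up_step, vert_step, up_step] w}"

definition uvu_free_up :: "lattice_path set" where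
  "uvu_free_up = {w \<in> uvu_free. \<exists>v. w = up_step # v}"

lemma uvu_avoiding_paths_eq: "uvu_avoiding_paths n = {w. w \<in> uvu_free \<and> path_length w = n}"
proof -
  have "fst (sum_list w) = int (path_length w)" if "set w \<subseteq> g_steps" for w
    using that by (induction w) (auto simp: path_length_def step_defs)
  then have "fst (sum_list w) = int (path_length w)" if "w \<in> excursions g_steps" for w
    using that by (auto simp: excursions_def)
  then show ?thesis
    by (auto simp: uvu_avoiding_paths_def g_motzkin_paths_def lattice_paths_eq_excursions uvu_free_def)
qed

lemma g_excursions_unfold:
  "w \<in> excursions g_steps \<longleftrightarrow> w = [] \<or> (\<exists>v\<in>excursions g_steps. w = horiz_step # v) \<or>
    (\<exists>d\<in>{down_step, vert_step}. \<exists>a\<in>excursions g_steps. \<exists>b\<in>excursions g_steps.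
       w = up_step # a @ d # b)"
proof -
  have "snd s \<in> {-1, 0, 1}" if "s \<in> g_steps" for s
    using that by (auto simp: step_defs)
  then have "w \<in> excursions g_steps \<longleftrightarrow> w = [] \<or>
      (\<exists>s\<in>g_steps. \<exists>w'\<in>excursions g_steps. snd s = 0 \<and> w = s # w') \<or>
      (\<exists>u\<in>g_steps. \<exists>d\<in>g_steps. \<exists>a\<in>excursions g_steps. \<exists>b\<in>excursions g_steps.
         snd u = 1 \<and> snd d = -1 \<and> w = u # a @ d # b)"
    by (rule excursions_unfold)
  then show ?thesis
    by (simp add: step_defs bex_disj_distrib)
qed

text \<open>A forbidden word cannot straddle a boundary inside \<open>u a d b\<close> if \<open>a\<close> is nonempty: an
  excursion neither begins with \<open>v\<close> nor ends with \<open>u\<close>. So the only new occurrence uses the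
  initial \<open>u\<close>, an empty \<open>a\<close>, the step \<open>v\<close> and the first step of \<open>b\<close>.\<close>

lemma sublist_uvu_arch:
  assumes a: "a \<in> excursions g_steps" and s: "s \<in> {down_step, vert_step}"
  shows "sublist [up_step, vert_step, up_step] (up_step # a @ s # b) \<longleftrightarrow>
    sublist [up_step, vert_step, up_step] a \<or> sublist [up_step, vert_step, up_step] b \<or>
    a = [] \<and> s = vert_step \<and> (\<exists>v. b = up_step # v)"
proof -
  let ?f = "[up_step, vert_step, up_step]"
  have su: "s \<noteq> up_step" using s by (auto simp: step_defs)
  have "prefix ?f (up_step # a @ s # b) \<longleftrightarrow> a = [] \<and> s = vert_step \<and> (\<exists>v. b = up_step # v)"
  proof (cases a)
    case Nil
    then show ?thesis by (cases b) auto
  next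
    case (Cons t a')
    then have "t \<noteq> vert_step" using excursion_Cons_height[of t a'] a by (auto simp: step_defs)
    then show ?thesis using Cons by auto
  qed
  moreover have "sublist ?f (a @ s # b) \<longleftrightarrow> sublist ?f a \<or> sublist ?f b"
  proof -
    have last: "\<not> suffix [up_step] a"
      using excursion_snoc_height[of _ up_step g_steps] a by (auto simp: suffix_def step_defs)
    have "\<not> (suffix xs a \<and> prefix ys (s # b))" if "?f = xs @ ys" "ys \<noteq> ?f" "ys \<noteq> []" for xs ys
      using that last su by (auto simp: Cons_eq_append_conv)
    moreover have "\<not> prefix ?f (s # b)" using su by auto
    ultimately have "sublist ?f a" if "?f = xs @ ys" "suffix xs a" "prefix ys (s # b)" for xs ys
      using that by (cases "ys = []"; cases "xs = []") (auto simp del: prefix_Cons dest: suffix_imp_sublist)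
    then show ?thesis
      using \<open>\<not> prefix ?f (s # b)\<close>
      unfolding sublist_append sublist_Cons_right[of _ s b] by blast
  qed
  ultimately show ?thesis by (auto simp: sublist_Cons_right)
qed

definition arch :: "int \<times> int \<Rightarrow> lattice_path \<times> lattice_path \<Rightarrow> lattice_path" where
  "arch d = (\<lambda>(a, b). up_step # a @ d # b)"

lemma arch_in_uvu_free_up:
  assumes d: "d \<in> {down_step, vert_step}"
    and ab: "a \<in> excursions g_steps" "b \<in> excursions g_steps"
  shows "arch d (a, b) \<in> uvu_free_up \<longleftrightarrow>
    (a, b) \<in> uvu_free \<times> uvu_free \<and> (d = vert_step \<longrightarrow> (a, b) \<notin> {[]} \<times> uvu_free_up)"
proof -
  have "up_step # a @ d # b \<in> excursions g_steps"
    unfolding g_excursions_unfold[of "up_step # a @ d # b"] using assms by blast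
  then show ?thesis
    using ab by (auto simp: arch_def uvu_free_up_def uvu_free_def sublist_uvu_arch[OF ab(1) d])
qed

lemma uvu_free_up_eq:
  "uvu_free_up = arch down_step ` (uvu_free \<times> uvu_free) \<union>
     arch vert_step ` (uvu_free \<times> uvu_free - {[]} \<times> uvu_free_up)"
  (is "_ = ?R")
proof (intro set_eqI iffI)
  fix w assume w: "w \<in> uvu_free_up"
  then have "w \<in> excursions g_steps" "\<exists>v. w = up_step # v"
    by (auto simp: uvu_free_up_def uvu_free_def)
  then obtain d a b where d: "d \<in> {down_step, vert_step}"
    and ab: "a \<in> excursions g_steps" "b \<in> excursions g_steps" and "w = up_step # a @ d # b"
    unfolding g_excursions_unfold[of w] by (auto simp: step_defs)
  then have w': "w = arch d (a, b)" by (simp add: arch_def)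
  show "w \<in> ?R"
    using w d unfolding w' arch_in_uvu_free_up[OF d ab] by (elim insertE emptyE) simp_all
next
  have sub: "uvu_free \<subseteq> excursions g_steps" by (auto simp: uvu_free_def)
  fix w assume "w \<in> ?R"
  then obtain d a b where d: "d \<in> {down_step, vert_step}" and w: "w = arch d (a, b)"
    and ab: "(a, b) \<in> uvu_free \<times> uvu_free"
    and "d = vert_step \<longrightarrow> (a, b) \<notin> {[]} \<times> uvu_free_up"
  proof (elim UnE imageE)
    fix z assume "w = arch down_step z" "z \<in> uvu_free \<times> uvu_free"
    then show thesis using that[of down_step "fst z" "snd z"] by (auto simp: step_defs)
  next
    fix z assume "w = arch vert_step z" "z \<in> uvu_free \<times> uvu_free - {[]} \<times> uvu_free_up"
    then show thesis using that[of vert_step "fst z" "snd z"] by auto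
  qed
  moreover have "a \<in> excursions g_steps" "b \<in> excursions g_steps" using ab sub by auto
  ultimately show "w \<in> uvu_free_up" by (simp only: arch_in_uvu_free_up[OF d] simp_thms)
qed

lemma uvu_free_eq: "uvu_free = {[]} \<union> ((#) horiz_step ` uvu_free \<union> uvu_free_up)"
proof (intro set_eqI iffI)
  fix w assume w: "w \<in> uvu_free"
  then have "w \<in> excursions g_steps" by (simp add: uvu_free_def)
  then consider "w = []" | v where "w = horiz_step # v" "v \<in> excursions g_steps" | v where "w = up_step # v"
    unfolding g_excursions_unfold[of w] by auto
  then show "w \<in> {[]} \<union> ((#) horiz_step ` uvu_free \<union> uvu_free_up)"
    by cases (use w in \<open>auto simp: uvu_free_def uvu_free_up_def sublist_Cons_right\<close>)
next
  fix w assume "w \<in> {[]} \<union> ((#) horiz_step ` uvu_free \<union> uvu_free_up)"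
  then show "w \<in> uvu_free"
    by (auto simp: uvu_free_def uvu_free_up_def sublist_Cons_right level_step_excursion step_defs)
qed

lemma uvu_free_graded_finite: "graded_finite path_length uvu_free"
proof (rule graded_finite_subset)
  show "graded_finite path_length (excursions g_steps)"
    unfolding path_length_def[abs_def] by (rule excursions_graded_finite) (auto simp: step_defs)
qed (auto simp: uvu_free_def)

text \<open>The decomposition translated into series, for any statistic \<open>f\<close> that is additive over it.
  The raised part \<open>a\<close> contributes by its own function \<open>g\<close>, since raising shifts levels. The
  subtracted term \<open>g [] B + F\<^sub>u\<close> is the weight of the pairs \<open>([], b)\<close> with \<open>b\<close> starting with
  \<open>u\<close>, which would create a forbidden word.\<close>

lemma ogf_uvu_free_additive:
  fixes f g :: "lattice_path \<Rightarrow> rat"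
  assumes f_Nil: "f [] = e"
    and f_horiz: "\<And>w. w \<in> uvu_free \<Longrightarrow> f (horiz_step # w) = c + f w"
    and f_arch: "\<And>a b d. a \<in> uvu_free \<Longrightarrow> b \<in> uvu_free \<Longrightarrow> d \<in> {down_step, vert_step} \<Longrightarrow>
      f (up_step # a @ d # b) = g a + f b"
  defines "G \<equiv> ogf path_length (\<lambda>_. 1) uvu_free" and "F \<equiv> ogf path_length f uvu_free"
    and "\<Gamma> \<equiv> ogf path_length g uvu_free"
    and "B \<equiv> ogf path_length (\<lambda>_. 1) uvu_free_up" and "F\<^sub>u \<equiv> ogf path_length f uvu_free_up"
  shows "F = fps_const e + fps_X * (fps_const c * G + F) + F\<^sub>u"
    and "F\<^sub>u = (fps_X + fps_X ^ 2) * (\<Gamma> * G + G * F) - fps_X * (fps_const (g []) * B + F\<^sub>u)"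
proof -
  let ?E = uvu_free and ?U = uvu_free_up and ?H = "(#) horiz_step ` uvu_free"
  let ?sz2 = "\<lambda>(a, b). path_length a + path_length b" and ?gf = "\<lambda>(a, b). g a + f b"
  note fin = uvu_free_graded_finite
  have UE: "?U \<subseteq> ?E" by (auto simp: uvu_free_up_def)
  have finU: "graded_finite path_length ?U" by (rule graded_finite_subset[OF fin UE])
  have finN: "graded_finite path_length {[]}" by (simp add: graded_finite_def)
  have fin2: "graded_finite ?sz2 (?E \<times> ?E)" by (rule graded_finite_Times[OF fin fin])
  have finH: "graded_finite path_length ?H"
    by (rule graded_finite_image[OF fin, where c = 1]) (simp add: path_length_def horiz_step_def)
  have HU: "?H \<union> ?U \<subseteq> ?E" and Nil: "[] \<in> ?E"
    using equalityD2[OF uvu_free_eq] by simp_all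
  have "ogf path_length f ?E = ogf path_length f ({[]} \<union> (?H \<union> ?U))"
    by (subst uvu_free_eq) (rule refl)
  also have "\<dots> = ogf path_length f {[]} + ogf path_length f (?H \<union> ?U)"
    by (rule ogf_Un[OF finN graded_finite_subset[OF fin HU]]) (auto simp: uvu_free_up_def)
  also have "ogf path_length f (?H \<union> ?U) = ogf path_length f ?H + ogf path_length f ?U"
    by (rule ogf_Un[OF finH finU]) (auto simp: uvu_free_up_def step_defs)
  also have "ogf path_length f ?H = fps_X ^ 1 * ogf path_length (\<lambda>w. f (horiz_step # w)) ?E"
    by (rule ogf_image) (auto simp: path_length_def horiz_step_def)
  also have "ogf path_length (\<lambda>w. f (horiz_step # w)) ?E = ogf path_length (\<lambda>w. c + f w) ?E"
    by (rule ogf_cong) (rule f_horiz)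
  also have "\<dots> = fps_const c * G + F"
    by (simp only: ogf_add ogf_const[of _ c] G_def F_def)
  also have "ogf path_length f {[]} = fps_const e"
    by (simp add: ogf_singleton path_length_def f_Nil)
  finally show "F = fps_const e + fps_X * (fps_const c * G + F) + F\<^sub>u"
    by (simp only: F_def[symmetric] F\<^sub>u_def[symmetric] power_one_right add.assoc)

  let ?D = "arch down_step ` (?E \<times> ?E)" and ?W = "?E \<times> ?E - {[]} \<times> ?U"
  let ?V = "arch vert_step ` ?W"
  have szD: "path_length (arch down_step z) = ?sz2 z + 2" for z
    by (auto simp: path_length_def arch_def step_defs split: prod.split)
  have szV: "path_length (arch vert_step z) = ?sz2 z + 1" for z
    by (auto simp: path_length_def arch_def step_defs split: prod.split)
  have inj: "inj_on (arch d) S" if "d \<in> {down_step, vert_step}" "S \<subseteq> ?E \<times> ?E" for d S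
    unfolding arch_def
    by (rule inj_on_arch[where A = g_steps]) (use that in \<open>auto simp: step_defs uvu_free_def\<close>)
  have disj: "?D \<inter> ?V = {}"
  proof -
    have "arch down_step (a, b) \<noteq> arch vert_step (a', b')" if "a \<in> ?E" "a' \<in> ?E" for a b a' b'
      using first_descent_unique[of a down_step b a' vert_step b' g_steps] that
      by (auto simp: arch_def uvu_free_def step_defs)
    then show ?thesis by auto
  qed
  have DU: "?D \<subseteq> ?U" and VU: "?V \<subseteq> ?U"
    using equalityD2[OF uvu_free_up_eq] by simp_all
  have "F\<^sub>u = ogf path_length f (?D \<union> ?V)"
    unfolding F\<^sub>u_def by (subst uvu_free_up_eq) (rule refl)
  also have "\<dots> = ogf path_length f ?D + ogf path_length f ?V"
    by (intro ogf_Un graded_finite_subset[OF finU] DU VU disj)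
  also have "ogf path_length f ?D = fps_X ^ 2 * ogf ?sz2 (\<lambda>z. f (arch down_step z)) (?E \<times> ?E)"
    by (rule ogf_image) (auto simp: inj szD)
  also have "ogf ?sz2 (\<lambda>z. f (arch down_step z)) (?E \<times> ?E) = ogf ?sz2 ?gf (?E \<times> ?E)"
    by (rule ogf_cong) (auto simp: arch_def f_arch)
  also have "ogf path_length f ?V = fps_X ^ 1 * ogf ?sz2 (\<lambda>z. f (arch vert_step z)) ?W"
    by (rule ogf_image) (auto simp: inj szV)
  also have "ogf ?sz2 (\<lambda>z. f (arch vert_step z)) ?W = ogf ?sz2 ?gf ?W"
    by (rule ogf_cong) (auto simp: arch_def f_arch)
  also have "\<dots> = ogf ?sz2 ?gf (?E \<times> ?E) - ogf ?sz2 ?gf ({[]} \<times> ?U)"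
    by (rule ogf_Diff[OF fin2]) (use UE Nil in auto)
  also have "ogf ?sz2 ?gf (?E \<times> ?E) = \<Gamma> * G + G * F"
    by (simp only: ogf_Times_sum[OF fin fin] \<Gamma>_def G_def F_def)
  also have "ogf ?sz2 ?gf ({[]} \<times> ?U) = fps_const (g []) * B + F\<^sub>u"
    by (simp only: ogf_Times_sum[OF finN finU])
      (simp add: ogf_singleton path_length_def B_def F\<^sub>u_def)
  also have "fps_X ^ 2 * (\<Gamma> * G + G * F) + fps_X ^ 1 * (\<Gamma> * G + G * F - (fps_const (g []) * B + F\<^sub>u)) =
      (fps_X + fps_X ^ 2) * (\<Gamma> * G + G * F) - fps_X * (fps_const (g []) * B + F\<^sub>u)"
    by (simp add: ring_distribs)
  finally show "F\<^sub>u = (fps_X + fps_X ^ 2) * (\<Gamma> * G + G * F) - fps_X * (fps_const (g []) * B + F\<^sub>u)" .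
qed

section \<open>Counting paths and points by level\<close>

abbreviation uvu_free_fps :: "(lattice_path \<Rightarrow> rat) \<Rightarrow> rat fps" where
  "uvu_free_fps f \<equiv> ogf path_length f uvu_free"

lemma one_plus_X_nonzero: "1 + fps_X \<noteq> (0 :: rat fps)"
proof
  assume "1 + fps_X = (0 :: rat fps)"
  then have "fps_nth (1 + fps_X :: rat fps) 0 = 0" by simp
  then show False by simp
qed

lemma uvu_free_fps_eq:
  "uvu_free_fps (\<lambda>_. 1) = schroeder_fps"
  "ogf path_length (\<lambda>_. 1) uvu_free_up = fps_X * schroeder_fps ^ 2"
proof -
  let ?G = "uvu_free_fps (\<lambda>_. 1)" and ?B = "ogf path_length (\<lambda>_. 1) uvu_free_up"
  have eqs: "?G = 1 + fps_X * ?G + ?B" "?B = (fps_X + fps_X ^ 2) * (?G * ?G) - fps_X * ?B"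
    using ogf_uvu_free_additive[of "\<lambda>_. 1" 1 0 "\<lambda>_. 0"] by (simp_all add: ogf_zero)
  have "(1 + fps_X) * ?B = (1 + fps_X) * (fps_X * ?G ^ 2)"
    using eqs(2) by algebra
  then have B: "?B = fps_X * ?G ^ 2"
    using one_plus_X_nonzero by simp
  then show "?G = schroeder_fps"
    using eqs(1) by (intro schroeder_fps_unique) simp
  with B show "?B = fps_X * schroeder_fps ^ 2" by simp
qed

lemma card_uvu_avoiding_paths: "card (uvu_avoiding_paths n) = schroeder n"
proof -
  have "of_nat (card (uvu_avoiding_paths n)) = fps_nth (uvu_free_fps (\<lambda>_. 1)) n"
    by (simp add: ogf_def uvu_avoiding_paths_eq)
  then have "of_nat (card (uvu_avoiding_paths n)) = (of_nat (schroeder n) :: rat)"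
    unfolding uvu_free_fps_eq(1) by (simp add: schroeder_fps_def)
  then show ?thesis by simp
qed

text \<open>Levels are integers here, because the recursion lowers the level when a step goes up.\<close>

fun visits :: "int \<Rightarrow> lattice_path \<Rightarrow> nat" where
  "visits l [] = of_bool (l = 0)"
| "visits l (s # w) = of_bool (l = 0) + visits (l - snd s) w"

lemma card_atMost_Suc_split:
  "card {k. k \<le> Suc n \<and> Q k} = of_bool (Q 0) + card {k. k \<le> n \<and> Q (Suc k)}"
proof -
  have "{k. k \<le> Suc n \<and> Q k} = (if Q 0 then {0} else {}) \<union> Suc ` {k. k \<le> n \<and> Q (Suc k)}"
    by (auto simp: image_iff gr0_conv_Suc) (metis Suc_le_mono not0_implies_Suc)+
  then show ?thesis by (simp add: card_insert_if card_image)
qed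

lemma card_lessThan_Suc_split:
  "card {k. k < Suc n \<and> Q k} = of_bool (Q 0) + card {k. k < n \<and> Q (Suc k)}"
proof -
  have "{k. k < Suc n \<and> Q k} = (if Q 0 then {0} else {}) \<union> Suc ` {k. k < n \<and> Q (Suc k)}"
    by (auto simp: image_iff gr0_conv_Suc) (metis Suc_less_eq not0_implies_Suc)+
  then show ?thesis by (simp add: card_insert_if card_image)
qed

lemma visits_eq_card: "visits l w = card {k. k \<le> length w \<and> height (take k w) = l}"
proof (induction w arbitrary: l)
  case Nil
  then show ?case by auto
next
  case (Cons s w)
  have "{k. k \<le> length w \<and> height (take k w) = l - snd s} =
      {k. k \<le> length w \<and> height (take (Suc k) (s # w)) = l}" by auto
  then show ?case
    using Cons.IH[of "l - snd s"]
      card_atMost_Suc_split[of "length w" "\<lambda>k. height (take k (s # w)) = l"] by simp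
qed

lemma points_at_level_eq_visits: "points_at_level l w = visits (int l) w"
  by (simp add: points_at_level_def visits_eq_card path_point_def height_def)

lemma visits_append:
  "visits l (a @ b) + of_bool (l = height a) = visits l a + visits (l - height a) b"
proof (induction a arbitrary: l)
  case (Cons s a)
  have "l - snd s = height a \<longleftrightarrow> l = snd s + height a" by auto
  then show ?case using Cons.IH[of "l - snd s"] by (simp add: diff_diff_eq)
qed simp

text \<open>The endpoint of \<open>a\<close> is the starting point of the step \<open>d\<close>, and the endpoint of \<open>d\<close> is the
  starting point of \<open>b\<close>, so both are counted by the recursive calls and only the origin is extra.\<close>

lemma visits_arch:
  assumes "a \<in> excursions A" "snd u = 1" "snd d = -1"
  shows "visits l (u # a @ d # b) = of_bool (l = 0) + visits (l - 1) a + visits l b"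
  using visits_append[of "l - 1" a "d # b"] assms by (simp add: excursions_def)

lemma visits_below: "(\<forall>p. prefix p w \<longrightarrow> l < height p) \<Longrightarrow> visits l w = 0"
  by (auto simp: visits_eq_card) (metis take_is_prefix less_irrefl)

text \<open>Here \<open>c\<close> counts the origin: it is a point at level \<open>l\<close> exactly for \<open>l = 0\<close>. The raised part is
  weighted by \<open>c + visits (l - 1)\<close>, whose value at the empty path is \<open>c + of_bool (l = 1)\<close>.
  After eliminating the paths that start with \<open>u\<close>, multiplying by \<open>S\<close> and using
  \<open>S (1 - x - x S) = 1\<close> leaves \<open>F l\<close> alone on the left.\<close>

lemma visits_fps_rec:
  fixes l :: int
  defines "F \<equiv> \<lambda>l. uvu_free_fps (\<lambda>w. of_nat (visits l w))"
    and "c \<equiv> of_bool (l = 0)" and "S \<equiv> schroeder_fps"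
  shows "(1 + fps_X) * F l =
    (1 + fps_X) * (S * (c + fps_X * c * S + fps_X * S * (c * S + F (l - 1)))) -
    fps_X ^ 2 * (c + of_bool (l = 1)) * S ^ 3"
proof -
  let ?c = "of_bool (l = 0) :: rat"
  let ?f = "\<lambda>w. of_nat (visits l w)" and ?g = "\<lambda>w. ?c + of_nat (visits (l - 1) w)"
  let ?Fu = "ogf path_length ?f uvu_free_up"
  have c: "fps_const ?c = c" by (simp add: c_def)
  have g0: "fps_const (?g []) = c + of_bool (l = 1)" by (simp add: c_def)
  have "uvu_free_fps ?g = c * S + F (l - 1)"
    by (simp only: ogf_add ogf_const[of _ ?c] uvu_free_fps_eq c F_def S_def)
  moreover have "?f (up_step # a @ d # b) = ?g a + ?f b"
    if "a \<in> uvu_free" "d \<in> {down_step, vert_step}" for a b d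
    using that visits_arch[of a g_steps up_step d l b] by (auto simp: uvu_free_def step_defs)
  moreover have "?f [] = ?c" by simp
  moreover have "?f (horiz_step # w) = ?c + ?f w" for w
    by (simp add: horiz_step_def)
  ultimately have
    "F l = c + fps_X * (c * S + F l) + ?Fu"
    "?Fu = (fps_X + fps_X ^ 2) * ((c * S + F (l - 1)) * S + S * F l) -
      fps_X * ((c + of_bool (l = 1)) * (fps_X * S ^ 2) + ?Fu)"
    using ogf_uvu_free_additive[of ?f ?c ?c ?g]
    by (simp_all only: uvu_free_fps_eq c g0 F_def S_def)
  moreover have "S = 1 + fps_X * S + fps_X * S ^ 2"
    unfolding S_def by (rule schroeder_fps_eq)
  ultimately show ?thesis by algebra
qed

lemma visits_fps_0:
  "(1 + fps_X) * uvu_free_fps (\<lambda>w. of_nat (visits 0 w)) =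
    (1 + fps_X) * schroeder_fps ^ 2 - fps_X ^ 2 * schroeder_fps ^ 3"
proof -
  \<comment> \<open>Nothing lies below the axis, so the recurrence starts at level \<open>0\<close>.\<close>
  have "visits (-1) w = 0" if "w \<in> uvu_free" for w
    using that by (intro visits_below) (auto simp: uvu_free_def excursions_def intro: less_le_trans)
  then have "uvu_free_fps (\<lambda>w. of_nat (visits (-1) w)) = 0"
    using ogf_cong[of uvu_free "\<lambda>w. of_nat (visits (-1) w)" "\<lambda>_. 0"] by (simp add: ogf_zero)
  then show ?thesis
    using visits_fps_rec[of 0] schroeder_fps_eq by simp algebra
qed

text \<open>The recurrence gives \<open>(1 + x) F\<^sub>1 = x S\<^sup>2 (1 + x) F\<^sub>0 - x\<^sup>2 S\<^sup>3 = x S\<^sup>3 ((1 + x) S - x (1 + x S\<^sup>2))\<close>.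
  The last factor is \<open>(1 + x\<^sup>2) S\<close>, by the equation of \<open>S\<close>.\<close>

lemma visits_fps_1:
  "(1 + fps_X) * uvu_free_fps (\<lambda>w. of_nat (visits 1 w)) =
    fps_X * (1 + fps_X ^ 2) * schroeder_fps ^ 4"
  using visits_fps_rec[of 1] visits_fps_0 schroeder_fps_eq by simp algebra

lemma visits_fps_Suc:
  assumes "l \<ge> 2"
  shows "uvu_free_fps (\<lambda>w. of_nat (visits l w)) =
    fps_X * schroeder_fps ^ 2 * uvu_free_fps (\<lambda>w. of_nat (visits (l - 1) w))"
proof -
  have "(1 + fps_X) * uvu_free_fps (\<lambda>w. of_nat (visits l w)) =
    (1 + fps_X) * (fps_X * schroeder_fps ^ 2 * uvu_free_fps (\<lambda>w. of_nat (visits (l - 1) w)))"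
    using visits_fps_rec[of l] assms by (simp add: power2_eq_square algebra_simps)
  then show ?thesis using one_plus_X_nonzero by simp
qed

lemma visits_fps_closed:
  "uvu_free_fps (\<lambda>w. of_nat (visits (int (Suc i)) w)) =
    fps_X * ((1 + fps_X ^ 2) * schroeder_fps ^ 4 / (1 + fps_X) * (fps_X * schroeder_fps ^ 2) ^ i)"
proof (induction i)
  case 0
  have unit: "fps_nth (1 + fps_X :: rat fps) 0 \<noteq> 0" by simp
  have "inverse (1 + fps_X) * (1 + fps_X) = (1 :: rat fps)"
    by (rule inverse_mult_eq_1[OF unit])
  then have "uvu_free_fps (\<lambda>w. of_nat (visits 1 w)) =
      fps_X * (1 + fps_X ^ 2) * schroeder_fps ^ 4 * inverse (1 + fps_X)"
    using visits_fps_1 by algebra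
  then show ?case by (simp add: fps_divide_unit[OF unit] mult.assoc)
next
  case (Suc i)
  then show ?case
    using visits_fps_Suc[of "int (Suc (Suc i))"] by (simp add: mult_ac)
qed

lemma P_num_eq_nth: "of_nat (P_num n l) = fps_nth (uvu_free_fps (\<lambda>w. of_nat (visits (int l) w))) n"
  by (simp add: P_num_def uvu_avoiding_paths_eq ogf_def points_at_level_eq_visits)

lemma P_num_riordan:
  "of_nat (P_num (n + 1) (i + 1)) =
    riordan_array ((1 + fps_X ^ 2) * schroeder_fps ^ 4 / (1 + fps_X))
      (fps_X * schroeder_fps ^ 2) n i"
  unfolding P_num_eq_nth riordan_array_def Suc_eq_plus1[symmetric] visits_fps_closed by simp

section \<open>Points at level zero\<close>

fun arrivals :: "int \<times> int \<Rightarrow> int \<Rightarrow> lattice_path \<Rightarrow> nat" where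
  "arrivals t l [] = 0"
| "arrivals t l (s # w) = of_bool (s = t \<and> snd s = l) + arrivals t (l - snd s) w"

lemma steps_at_level_eq_arrivals: "steps_at_level t l w = arrivals t (int l) w"
proof -
  have "card {k. k < length w \<and> w ! k = t \<and> height (take (Suc k) w) = l} = arrivals t l w" for l
  proof (induction w arbitrary: l)
    case (Cons s w)
    have "{k. k < length w \<and> w ! k = t \<and> height (take (Suc k) w) = l - snd s} =
      {k. k < length w \<and> (s # w) ! Suc k = t \<and> height (take (Suc (Suc k)) (s # w)) = l}" by auto
    then show ?case
      using Cons.IH[of "l - snd s"] card_lessThan_Suc_split[of "length w"
        "\<lambda>k. (s # w) ! k = t \<and> height (take (Suc k) (s # w)) = l"] by simp
  qed simp
  then show ?thesis by (simp add: steps_at_level_def path_point_def height_def)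
qed

text \<open>Suppose the path stays at or above level \<open>l\<close>. A visit to \<open>l\<close> is the start, the end of an
  \<open>h\<close>, or the end of a descent from \<open>l + 1\<close>. Ascents to \<open>l + 1\<close> and descents to \<open>l\<close> alternate, so
  their numbers differ only through the endpoints of the path. If the path starts above \<open>l\<close>,
  the first descent is unmatched and takes the place of the start in the summand \<open>1\<close>; if it
  ends above \<open>l\<close>, the last ascent is unmatched, which the summand on the left accounts for.\<close>

lemma visits_lowest_level:
  assumes "set w \<subseteq> g_steps" "\<forall>p. prefix p w \<longrightarrow> l \<le> height p"
  shows "visits l w + of_bool (l < height w) =
    1 + arrivals up_step (l + 1) w + arrivals horiz_step l w"
  using assms
proof (induction w arbitrary: l)
  case (Cons s w)
  have pre: "l \<le> height p" if "prefix p (s # w)" for p using Cons.prems(2) that by blast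
  have "l \<le> 0" "l \<le> snd s" using pre[of "[]"] pre[of "[s]"] by auto
  moreover have "l - snd s \<le> height p" if "prefix p w" for p
    using pre[of "s # p"] that by simp
  then have "visits (l - snd s) w + of_bool (l - snd s < height w) =
    1 + arrivals up_step (l - snd s + 1) w + arrivals horiz_step (l - snd s) w"
    using Cons.prems(1) by (intro Cons.IH) auto
  moreover have "s \<in> g_steps" using Cons.prems(1) by simp
  ultimately show ?case
    by (auto simp: step_defs algebra_simps)
qed auto

lemma P_num_level_0: "P_num (n + 1) 0 = schroeder (n + 1) + U_num n 0 + H_num n 0"
proof -
  have "points_at_level 0 w = 1 + steps_at_level up_step 1 w + steps_at_level horiz_step 0 w"
    if "w \<in> uvu_avoiding_paths (n + 1)" for w
  proof -
    have "w \<in> excursions g_steps" using that by (simp add: uvu_avoiding_paths_eq uvu_free_def)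
    then show ?thesis
      using visits_lowest_level[of w 0]
      by (simp add: excursions_def points_at_level_eq_visits steps_at_level_eq_arrivals)
  qed
  then have "P_num (n + 1) 0 = (\<Sum>w\<in>uvu_avoiding_paths (n + 1).
      1 + steps_at_level up_step 1 w + steps_at_level horiz_step 0 w)"
    by (simp add: P_num_def)
  then show ?thesis
    by (simp only: sum.distrib U_num_def H_num_def card_uvu_avoiding_paths[symmetric] card_eq_sum add_0)
qed

section \<open>Coefficients of powers of the Schroeder series\<close>

text \<open>The numbers \<open>C\<^sub>m\<^sup>(\<^sup>k\<^sup>)\<close> as a difference of binomial coefficients. In this form the recurrence
  \<open>C\<^bsup>k+1\<^esup> = C\<^sup>k + z C\<^bsup>k+2\<^esup>\<close> of powers of the Catalan series is Pascal's rule, and the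
  values at \<open>k = 0\<close> are those of \<open>C\<^sup>0 = 1\<close>, whereas \<^const>\<open>catalan_conv\<close> is \<open>0\<close> at
  \<open>k = m = 0\<close> because it divides by \<open>0\<close>.\<close>

definition ballot :: "nat \<Rightarrow> nat \<Rightarrow> rat" where
  "ballot k m = of_nat ((2 * m + k - 1) choose m) -
    (if m = 0 then 0 else of_nat ((2 * m + k - 1) choose (m - 1)))"

lemma ballot_0_left: "ballot 0 m = of_bool (m = 0)"
proof (cases m)
  case (Suc j)
  have "(2 * j + 1) choose (Suc j) = (2 * j + 1) choose j"
    using binomial_symmetric[of j "2 * j + 1"] by simp
  then show ?thesis by (simp add: ballot_def Suc)
qed (simp add: ballot_def)

lemma ballot_0_right: "ballot k 0 = 1"
  by (simp add: ballot_def)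

lemma ballot_Suc: "ballot (Suc k) (Suc m) = ballot k (Suc m) + ballot (Suc (Suc k)) m"
  by (cases m) (simp_all add: ballot_def)

text \<open>Both binomial coefficients of the ballot form are rational multiples of
  \<open>(2 * m + k) choose m\<close>, with numerators \<open>m + k\<close> and \<open>m\<close> over \<open>2 * m + k\<close>.\<close>

lemma ballot_eq_catalan_conv:
  assumes "k > 0"
  shows "ballot k m = catalan_conv k m"
proof (cases m)
  case (Suc j)
  define n where "n = 2 * j + k + 1"
  have n: "2 * m + k = Suc n" "2 * m + k - 1 = n" using Suc by (auto simp: n_def)
  let ?c = "of_nat (Suc n choose Suc j) :: rat"
  have "Suc j * (Suc n choose Suc j) = Suc n * (n choose j)"
    using Suc_times_binomial_eq[of n j] by (simp only: mult.commute)
  then have low: "of_nat (Suc j) * ?c = of_nat (Suc n) * of_nat (n choose j)"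
    by (metis of_nat_mult)
  have "(Suc n - Suc j) * (Suc n choose Suc j) = Suc n * (n choose Suc j)"
    using binomial_absorb_comp[of "Suc n" "Suc j"] by simp
  then have "of_nat (Suc n - Suc j) * ?c = of_nat (Suc n) * of_nat (n choose Suc j)"
    by (metis of_nat_mult)
  moreover have "of_nat (Suc n - Suc j) = (of_nat (Suc j) + of_nat k :: rat)"
    by (simp add: n_def)
  ultimately have high: "(of_nat (Suc j) + of_nat k) * ?c = of_nat (Suc n) * of_nat (n choose Suc j)"
    by (simp only:)
  have "of_nat k * ?c = of_nat (Suc n) * ballot k m"
    using low high unfolding ballot_def n by (simp only: Suc nat.distinct diff_Suc_1 if_False) algebra
  then show ?thesis
    unfolding catalan_conv_def n by (simp add: Suc field_simps del: binomial_Suc_Suc of_nat_Suc)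
qed (use assms in \<open>simp add: ballot_def catalan_conv_def\<close>)

text \<open>The coefficient of \<open>x\<^sup>N\<close> in \<open>\<Sum>m. C\<^sub>m\<^sup>(\<^sup>k\<^sup>) x\<^sup>m / (1 - x)\<^bsup>2m+k\<^esup>\<close>, which is \<open>S\<^sup>k\<close> by
  \<open>S(x) = C(x / (1 - x)\<^sup>2) / (1 - x)\<close>. The truncated subtraction is harmless: for \<open>k = N = 0\<close> the
  binomial coefficient is \<open>0 choose 0\<close>, as it should be.\<close>

definition schroeder_conv :: "nat \<Rightarrow> nat \<Rightarrow> rat" where
  "schroeder_conv k N = (\<Sum>m=0..N. of_nat ((N + m + k - 1) choose (N - m)) * ballot k m)"

lemma schroeder_conv_0_left: "schroeder_conv 0 N = of_bool (N = 0)"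
proof -
  have "schroeder_conv 0 N = of_nat ((N - 1) choose N)"
    by (simp add: schroeder_conv_def ballot_0_left sum.atLeast_Suc_atMost)
  then show ?thesis by (cases N) auto
qed

lemma schroeder_conv_0_right: "schroeder_conv k 0 = 1"
  by (simp add: schroeder_conv_def ballot_0_right)

text \<open>This is \<open>(1 - x) T\<^bsub>k+1\<^esub> = T\<^sub>k + x T\<^bsub>k+2\<^esub>\<close> for the series \<open>T\<^sub>k\<close> of these numbers. Pascal's
  rule for the first factor is the multiplication by \<open>1 - x\<close>; the recurrence of the ballot
  numbers then splits the rest.\<close>

lemma schroeder_conv_rec:
  "schroeder_conv (Suc k) (Suc N) =
    schroeder_conv (Suc k) N + schroeder_conv k (Suc N) + schroeder_conv (Suc (Suc k)) N"
proof -
  have "schroeder_conv (Suc k) (Suc N) =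
      (\<Sum>m=0..Suc N. of_nat ((N + m + k) choose (Suc N - m)) * ballot (Suc k) m) +
      (\<Sum>m=0..N. of_nat ((N + m + k) choose (N - m)) * ballot (Suc k) m)"
  proof -
    have "of_nat ((Suc N + m + Suc k - 1) choose (Suc N - m)) * ballot (Suc k) m =
      of_nat ((N + m + k) choose (Suc N - m)) * ballot (Suc k) m +
      of_nat ((N + m + k) choose (N - m)) * ballot (Suc k) m" if "m \<le> N" for m
      using that by (simp add: Suc_diff_le algebra_simps)
    then show ?thesis
      by (simp add: schroeder_conv_def sum.distrib)
  qed
  also have "(\<Sum>m=0..N. of_nat ((N + m + k) choose (N - m)) * ballot (Suc k) m) = schroeder_conv (Suc k) N"
    by (simp add: schroeder_conv_def)
  also have "(\<Sum>m=0..Suc N. of_nat ((N + m + k) choose (Suc N - m)) * ballot (Suc k) m) =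
      schroeder_conv k (Suc N) + schroeder_conv (Suc (Suc k)) N"
    unfolding schroeder_conv_def sum.atLeast0_atMost_Suc_shift
    by (simp add: ballot_0_right ballot_Suc ring_distribs sum.distrib del: binomial_Suc_Suc)
  finally show ?thesis by simp
qed

text \<open>The recurrence expresses \<open>[x\<^bsup>N+1\<^esup>] S\<^bsup>k+1\<^esup>\<close> by coefficients of \<open>x\<^sup>N\<close> in higher powers and by
  \<open>[x\<^bsup>N+1\<^esup>] S\<^sup>k\<close>, hence the outer induction on \<open>N\<close> for all \<open>k\<close> and the inner one on \<open>k\<close>.\<close>

lemma schroeder_power_nth: "fps_nth (schroeder_fps ^ k) N = schroeder_conv k N"
proof (induction N arbitrary: k)
  case 0
  show ?case
    by (simp add: schroeder_conv_0_right fps_power_zeroth schroeder_fps_def schroeder_0)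
next
  case (Suc N)
  show ?case
  proof (induction k)
    case 0
    show ?case by (simp add: schroeder_conv_0_left)
  next
    case (Suc k)
    have "schroeder_fps ^ Suc k = schroeder_fps ^ k * (1 + fps_X * schroeder_fps + fps_X * schroeder_fps ^ 2)"
      using schroeder_fps_eq by simp
    also have "\<dots> = schroeder_fps ^ k + fps_X * schroeder_fps ^ Suc k + fps_X * schroeder_fps ^ Suc (Suc k)"
      by (simp add: algebra_simps power2_eq_square)
    finally have "fps_nth (schroeder_fps ^ Suc k) (Suc N) = fps_nth (schroeder_fps ^ k +
      fps_X * schroeder_fps ^ Suc k + fps_X * schroeder_fps ^ Suc (Suc k)) (Suc N)"
      by (rule arg_cong)
    also have "\<dots> = fps_nth (schroeder_fps ^ k) (Suc N) +
      fps_nth (schroeder_fps ^ Suc k) N + fps_nth (schroeder_fps ^ Suc (Suc k)) N"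
      by (simp only: fps_add_nth fps_X_mult_nth nat.distinct if_False diff_Suc_1)
    finally show ?case
      by (simp only: Suc.IH \<open>\<And>k. fps_nth (schroeder_fps ^ k) N = schroeder_conv k N\<close> schroeder_conv_rec)
  qed
qed

lemma fps_div_one_plus_X_nth:
  fixes f :: "rat fps"
  shows "fps_nth (f * inverse (1 + fps_X)) N = (\<Sum>j=0..N. (-1) ^ j * fps_nth f (N - j))"
  unfolding mult.commute[of f] fps_mult_nth by (simp add: fps_inverse_fps_X_plus1)

text \<open>The entry is \<open>[x\<^bsup>n-i\<^esup>] (T + x\<^sup>2 T)\<close> for \<open>T = S\<^bsup>2i+4\<^esup> / (1 + x)\<close>.\<close>

lemma riordan_explicit:
  assumes "i \<le> n"
  shows "riordan_array ((1 + fps_X ^ 2) * schroeder_fps ^ 4 / (1 + fps_X))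
        (fps_X * schroeder_fps ^ 2) n i =
    (\<Sum>j=0..n - i. (-1) ^ j *
        (\<Sum>m=0..n - i - j.
          of_nat ((n + m + i - j + 3) choose (n - i - j - m)) * catalan_conv (2 * i + 4) m)) +
      (\<Sum>j | i + j + 2 \<le> n. (-1) ^ j *
        (\<Sum>m=0..n - i - j - 2.
          of_nat ((n + m + i - j + 1) choose (n - i - j - m - 2)) * catalan_conv (2 * i + 4) m))"
proof -
  let ?T = "schroeder_fps ^ (2 * i + 4) * inverse (1 + fps_X)"
  have T: "fps_nth ?T N = (\<Sum>j=0..N. (-1) ^ j *
      (\<Sum>m=0..N - j. of_nat ((N - j + m + 2 * i + 3) choose (N - j - m)) * catalan_conv (2 * i + 4) m))" for N
  proof -
    have "a + (2 * i + 4) - 1 = a + 2 * i + 3" for a by simp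
    moreover have "ballot (2 * i + 4) m = catalan_conv (2 * i + 4) m" for m
      by (rule ballot_eq_catalan_conv) simp
    ultimately show ?thesis
      by (simp only: fps_div_one_plus_X_nth schroeder_power_nth schroeder_conv_def)
  qed
  have unit: "fps_nth (1 + fps_X :: rat fps) 0 \<noteq> 0" by simp
  have "(1 + fps_X ^ 2) * schroeder_fps ^ 4 / (1 + fps_X) * (fps_X * schroeder_fps ^ 2) ^ i =
      fps_X ^ i * (?T + fps_X ^ 2 * ?T)"
    unfolding fps_divide_unit[OF unit] power_mult_distrib power_add power_mult by algebra
  then have "riordan_array ((1 + fps_X ^ 2) * schroeder_fps ^ 4 / (1 + fps_X))
        (fps_X * schroeder_fps ^ 2) n i =
      fps_nth ?T (n - i) + (if n - i < 2 then 0 else fps_nth ?T (n - i - 2))"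
    using assms by (simp add: riordan_array_def fps_X_power_mult_nth)
  also have "fps_nth ?T (n - i) = (\<Sum>j=0..n - i. (-1) ^ j *
        (\<Sum>m=0..n - i - j.
          of_nat ((n + m + i - j + 3) choose (n - i - j - m)) * catalan_conv (2 * i + 4) m))"
    unfolding T
  proof (intro sum.cong arg_cong2[of _ _ _ _ "(*)"] refl)
    fix j m assume "j \<in> {0..n - i}"
    then have "n - i - j + m + 2 * i + 3 = n + m + i - j + 3" using assms by auto
    then show "of_nat ((n - i - j + m + 2 * i + 3) choose (n - i - j - m)) =
      (of_nat ((n + m + i - j + 3) choose (n - i - j - m)) :: rat)" by (simp only:)
  qed
  also have "(if n - i < 2 then 0 else fps_nth ?T (n - i - 2)) = (\<Sum>j | i + j + 2 \<le> n. (-1) ^ j *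
        (\<Sum>m=0..n - i - j - 2.
          of_nat ((n + m + i - j + 1) choose (n - i - j - m - 2)) * catalan_conv (2 * i + 4) m))"
  proof (cases "n - i < 2")
    case True
    then have "{j. i + j + 2 \<le> n} = {}" by auto
    with True show ?thesis by simp
  next
    case False
    then have set: "{j. i + j + 2 \<le> n} = {0..n - i - 2}" by auto
    have "fps_nth ?T (n - i - 2) = (\<Sum>j | i + j + 2 \<le> n. (-1) ^ j *
        (\<Sum>m=0..n - i - j - 2.
          of_nat ((n + m + i - j + 1) choose (n - i - j - m - 2)) * catalan_conv (2 * i + 4) m))"
      unfolding T set
    proof (intro sum.cong arg_cong2[of _ _ _ _ "(*)"] refl)
      fix j m assume "j \<in> {0..n - i - 2}"
      then have "n - i - 2 - j + m + 2 * i + 3 = n + m + i - j + 1"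
        "n - i - 2 - j - m = n - i - j - m - 2" using assms False by auto
      then show "of_nat ((n - i - 2 - j + m + 2 * i + 3) choose (n - i - 2 - j - m)) =
        (of_nat ((n + m + i - j + 1) choose (n - i - j - m - 2)) :: rat)" by (simp only:)
    qed simp
    with False show ?thesis by simp
  qed
  finally show ?thesis .
qed

theorem theorem4p7:
  fixes n i :: nat
  assumes "i \<le> n"
  shows "P_num (n + 1) 0 = schroeder (n + 1) + U_num n 0 + H_num n 0 \<and>
    rat_of_nat (P_num (n + 1) (i + 1)) =
      (\<Sum>j=0..n - i. (-1) ^ j *
        (\<Sum>m=0..n - i - j.
          of_nat ((n + m + i - j + 3) choose (n - i - j - m)) * catalan_conv (2 * i + 4) m)) +
      (\<Sum>j | i + j + 2 \<le> n. (-1) ^ j *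
        (\<Sum>m=0..n - i - j - 2.
          of_nat ((n + m + i - j + 1) choose (n - i - j - m - 2)) * catalan_conv (2 * i + 4) m)) \<and>
    rat_of_nat (P_num (n + 1) (i + 1)) =
      riordan_array ((1 + fps_X ^ 2) * schroeder_fps ^ 4 / (1 + fps_X))
        (fps_X * schroeder_fps ^ 2) n i"
  using P_num_level_0[of n] P_num_riordan[of n i] riordan_explicit[OF assms] by simp

end
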